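(* Consider the quadratic program $$\text{minimize}_{\bm{\theta}\in\mathbb{R}^n}\ f(\bm{\theta})=\tfrac12\bm{\theta}^\top\bm{Q}\bm{\theta}+\bm{b}^\top\bm{\theta}\quad\text{subject to}\quad\bm{A}^\top\bm{\theta}\le\bm{c},$$ where $\bm{A}=(\bm{a}_1,\ldots,\bm{a}_p)\in\mathbb{R}^{n\times p}$, $\bm{b}\in\mathbb{R}^n$, $\bm{c}\in\mathbb{R}^p$. Suppose that $\bm{Q}$ is symmetric positive semidefinite, $\bm{A}$ has full row rank, i.e., $\mathrm{rank}\,\bm{A}=n$, and the quadratic program has an interior point (a $\bm\theta$ with $\bm{A}^\top\bm{\theta}<\bm{c}$) and an optimum. Let $\bm{\Sigma}$ be a symmetric positive definite $n\times n$ matrix with $\bm{\Sigma}^{-1}-\bm{Q}$ positive definite, and let $\{\bm{\theta}^{(t)}\}_{t\ge0}$ be generated from an interior point $\bm{\theta}^{(0)}$ of the feasible region by $$\bm{\theta}^{(t)}\in\arg\min_{\bm{\theta}}\Big\{-\sum_{j=1}^p\big(\bm{a}_j^\top\bm{\theta}+\mu_j^{(t-1)}\ln(c_j-\bm{a}_j^\top\bm{\theta})\big)+\tfrac12\bm{\theta}^\top\bm{\Sigma}^{-1}\bm{\theta}+(\bm{\nu}^{(t-1)})^\top\bm{\theta}\Big\},$$ where $\mu_j^{(t-1)}:=c_j-\bm{a}_j^\top\bm{\theta}^{(t-1)}$ and $\bm{\nu}^{(t-1)}:=\bm{b}-(\bm{\Sigma}^{-1}-\bm{Q})\bm{\theta}^{(t-1)}$.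 Then $\{\bm{\theta}^{(t)}\}_{t\ge0}$ converges to an optimal solution $\bm{\theta}^\star$ of the quadratic program. Moreover, if $X^\star:=\{\bm{\theta}: f(\bm{\theta})=f(\bm{\theta}^\star)\}\ne\emptyset$, the sequence $\{\bm{\theta}^{(t)}\}_{t\ge 0}$ converges to an optimal solution of the quadratic program.
   Context: In the iteration, the minimization is over all $\bm{\theta}\in\mathbb{R}^n$ with $c_j-\bm{a}_j^\top\bm{\theta}>0$ for all $j$ (the domain of the logarithms), and $\bm{a}_j$ is the $j$-th column of $\bm{A}$. Vector inequalities are componentwise. *)

theory Defs
  imports "HOL-Analysis.Analysis"
begin

text \<open>Symmetry is not part of the following two definitions; it is stated separately.\<close>

definition pos_semidef :: "real^'n^'n \<Rightarrow> bool" where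
  "pos_semidef M \<longleftrightarrow> (\<forall>x. 0 \<le> x \<bullet> (M *v x))"

definition pos_def :: "real^'n^'n \<Rightarrow> bool" where
  "pos_def M \<longleftrightarrow> (\<forall>x. x \<noteq> 0 \<longrightarrow> 0 < x \<bullet> (M *v x))"

definition qp_obj :: "real^'n^'n \<Rightarrow> real^'n \<Rightarrow> real^'n \<Rightarrow> real" where
  "qp_obj Q b \<theta> = (1/2) * (\<theta> \<bullet> (Q *v \<theta>)) + b \<bullet> \<theta>"

definition qp_feasible :: "real^'p^'n \<Rightarrow> real^'p \<Rightarrow> real^'n \<Rightarrow> bool" where
  "qp_feasible A c \<theta> \<longleftrightarrow> (\<forall>j. (transpose A *v \<theta>) $ j \<le> c $ j)"

text \<open>Written out by components, because \<open><\<close> on \<open>real^'p\<close> is the strict part of the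
  componentwise order \<open>\<le>\<close>, not strict inequality in every component.\<close>

definition qp_interior :: "real^'p^'n \<Rightarrow> real^'p \<Rightarrow> real^'n \<Rightarrow> bool" where
  "qp_interior A c \<theta> \<longleftrightarrow> (\<forall>j. (transpose A *v \<theta>) $ j < c $ j)"

definition qp_optimal ::
  "real^'n^'n \<Rightarrow> real^'n \<Rightarrow> real^'p^'n \<Rightarrow> real^'p \<Rightarrow> real^'n \<Rightarrow> bool" where
  "qp_optimal Q b A c \<theta> \<longleftrightarrow> is_arg_min (qp_obj Q b) (qp_feasible A c) \<theta>"

definition slack :: "real^'p^'n \<Rightarrow> real^'p \<Rightarrow> real^'n \<Rightarrow> 'p \<Rightarrow> real" where
  "slack A c \<theta> j = c $ j - column j A \<bullet> \<theta>"

text \<open>The function minimized in one step; \<open>\<theta>'\<close> is the previous iterate, at which the weights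
  \<open>\<mu>\<close> and the linear term \<open>\<nu>\<close> are evaluated.\<close>

definition step_obj ::
  "real^'n^'n \<Rightarrow> real^'n \<Rightarrow> real^'p^'n \<Rightarrow> real^'p \<Rightarrow> real^'n^'n \<Rightarrow> real^'n \<Rightarrow> real^'n \<Rightarrow> real" where
  "step_obj Q b A c \<Sigma> \<theta>' \<theta> =
     (let \<mu> = slack A c \<theta>';
          \<nu> = b - (matrix_inv \<Sigma> - Q) *v \<theta>'
      in - (\<Sum>j\<in>UNIV. column j A \<bullet> \<theta> + \<mu> j * ln (slack A c \<theta> j))
         + (1/2) * (\<theta> \<bullet> (matrix_inv \<Sigma> *v \<theta>)) + \<nu> \<bullet> \<theta>)"

text \<open>The minimization is over the domain of the logarithms; the restriction matters
  because \<^const>\<open>ln\<close> is a total function on the reals.\<close>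

definition qp_step ::
  "real^'n^'n \<Rightarrow> real^'n \<Rightarrow> real^'p^'n \<Rightarrow> real^'p \<Rightarrow> real^'n^'n \<Rightarrow> real^'n \<Rightarrow> real^'n \<Rightarrow> bool" where
  "qp_step Q b A c \<Sigma> \<theta>' \<theta> \<longleftrightarrow>
     is_arg_min (step_obj Q b A c \<Sigma> \<theta>') (\<lambda>\<theta>. \<forall>j. 0 < slack A c \<theta> j) \<theta>"

end

theory Submission
  imports Defs
begin

text \<open>
  Write \<open>s\<^sub>j\<close> for the slacks, \<open>P = \<Sigma>\<inverse> - Q\<close> and \<open>d(y, s) = y ln (y/s) - y + s\<close>. Up to a constant, one
  step minimizes \<open>f(\<theta>) + \<Sum>\<^sub>j d(s\<^sub>j(\<theta>'), s\<^sub>j(\<theta>)) + (\<theta> - \<theta>')\<^sup>T P (\<theta> - \<theta>') / 2\<close>, so it is a proximal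
  point step. Its first-order condition together with convexity of \<open>f\<close> and \<open>ln u \<le> u - 1\<close> gives
  \<open>f(\<theta>\<^sup>+) - f(x) \<le> V\<^sub>x(\<theta>) - V\<^sub>x(\<theta>\<^sup>+)\<close> for every feasible \<open>x\<close>, where
  \<open>V\<^sub>x(\<theta>) = \<Sum>\<^sub>j d(s\<^sub>j(x), s\<^sub>j(\<theta>)) + (x - \<theta>)\<^sup>T P (x - \<theta>) / 2\<close>. Taking \<open>x\<close> optimal, the iterates are
  bounded and their objective values tend to the optimal value, so some cluster point \<open>x\<close> is
  optimal; \<open>V\<^sub>x\<close> is decreasing along the iterates and tends to \<open>0\<close> on a subsequence, hence
  tends to \<open>0\<close>.
\<close>

section \<open>Scalar relative entropy\<close>

definition kl_div :: "real \<Rightarrow> real \<Rightarrow> real" where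
  "kl_div y s = y * ln (y / s) - y + s"

lemma kl_div_nonneg:
  assumes "0 \<le> y" "0 < s"
  shows "0 \<le> kl_div y s"
proof (cases "y = 0")
  case False
  then have y: "0 < y" using assms by simp
  have "y * ln (s / y) \<le> y * (s / y - 1)"
    using y assms ln_le_minus_one[of "s / y"] by (intro mult_left_mono) auto
  also have "\<dots> = s - y" using y by (simp add: field_simps)
  finally show ?thesis
    using y assms by (simp add: kl_div_def ln_div algebra_simps)
qed (use assms in \<open>simp add: kl_div_def\<close>)

text \<open>The terms in \<open>ln y\<close> cancel in the difference, and
  \<open>ln u \<le> u - 1\<close> at \<open>u = s / s'\<close> bounds what is left. The factor
  \<open>s / s' - 1\<close> is the one in the first-order condition of a step.\<close>

lemma kl_div_diff_ge:
  assumes "0 \<le> y" "0 < s" "0 < s'"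
  shows "- ((y - s') * (s / s' - 1)) \<le> kl_div y s - kl_div y s'"
proof -
  have *: "y * ln (s / s') \<le> y * (s / s' - 1)"
    using assms ln_le_minus_one[of "s / s'"] by (intro mult_left_mono) auto
  have "s' * (s / s' - 1) = s - s'" using assms by (simp add: field_simps)
  moreover have "kl_div y s - kl_div y s' = - (y * ln (s / s')) + s - s'"
    using assms by (cases "y = 0") (simp_all add: kl_div_def ln_div algebra_simps)
  ultimately show ?thesis using * by (simp add: left_diff_distrib)
qed

text \<open>The case \<open>y = 0\<close>, where \<open>kl_div 0 s = s\<close>, covers limit points
  on the boundary of the feasible region.\<close>

lemma tendsto_kl_div_self:
  assumes "0 \<le> y" "(f \<longlongrightarrow> y) F"
  shows "((\<lambda>i. kl_div y (f i)) \<longlongrightarrow> 0) F"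
proof (cases "y = 0")
  case False
  then have "((\<lambda>i. y * ln (y / f i) - y + f i) \<longlongrightarrow> y * ln (y / y) - y + y) F"
    using assms by (intro tendsto_intros) auto
  then show ?thesis using False by (simp add: kl_div_def)
qed (use assms in \<open>simp add: kl_div_def\<close>)

section \<open>Symmetric and positive definite matrices\<close>

lemma symmetric_matrix_inner:
  fixes M :: "real^'n^'n"
  assumes "transpose M = M"
  shows "x \<bullet> (M *v y) = y \<bullet> (M *v x)"
  by (metis assms dot_lmul_matrix inner_commute transpose_matrix_vector)

lemma pos_def_invertible:
  assumes "pos_def M"
  shows "invertible M"
proof -
  have "\<And>x. M *v x = 0 \<Longrightarrow> x = 0"
    using assms unfolding pos_def_def by (metis inner_zero_right less_irrefl)
  then show ?thesis
    using invertible_left_inverse matrix_left_invertible_ker by blast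
qed

lemma transpose_matrix_inv_symmetric:
  fixes M :: "real^'n^'n"
  assumes "transpose M = M" "invertible M"
  shows "transpose (matrix_inv M) = matrix_inv M"
proof -
  have inv: "M ** matrix_inv M = mat 1"
    using someI_ex[OF assms(2)[unfolded invertible_def]] by (simp add: matrix_inv_def)
  then have "transpose (matrix_inv M) ** M = mat 1"
    by (metis assms(1) matrix_transpose_mul transpose_mat)
  then show ?thesis
    by (metis inv matrix_mul_assoc matrix_mul_lid matrix_mul_rid)
qed

text \<open>The constant is the minimum of the quadratic form over the compact unit sphere;
  homogeneity of degree 2 extends the bound to all vectors.\<close>

lemma pos_def_coercive:
  fixes M :: "real^'n^'n"
  assumes "pos_def M"
  obtains m where "0 < m" "\<And>x. m * (norm x)\<^sup>2 \<le> x \<bullet> (M *v x)"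
proof -
  let ?S = "sphere (0::real^'n) 1"
  have "continuous_on ?S (\<lambda>x. x \<bullet> (M *v x))"
    by (intro continuous_intros linear_continuous_on matrix_vector_mul_linear)
      (simp add: linear_continuous_on linear_linear)
  moreover have "?S \<noteq> {}" by simp
  ultimately obtain u where u: "u \<in> ?S" "\<And>x. x \<in> ?S \<Longrightarrow> u \<bullet> (M *v u) \<le> x \<bullet> (M *v x)"
    using continuous_attains_inf[OF compact_sphere] by blast
  show thesis
  proof
    from u(1) have "u \<noteq> 0" by auto
    then show "0 < u \<bullet> (M *v u)" using assms by (simp add: pos_def_def)
    fix x :: "real^'n"
    show "u \<bullet> (M *v u) * (norm x)\<^sup>2 \<le> x \<bullet> (M *v x)"
    proof (cases "x = 0")
      case False
      then have "u \<bullet> (M *v u) \<le> sgn x \<bullet> (M *v sgn x)"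
        by (intro u(2)) (simp add: norm_sgn)
      also have "\<dots> = (x \<bullet> (M *v x)) / (norm x)\<^sup>2"
        by (simp add: sgn_div_norm matrix_vector_mult_scaleR power2_eq_square field_simps)
      finally show ?thesis using False by (simp add: field_simps)
    qed simp
  qed
qed

text \<open>Expand the last form along \<open>x - w = (x - z) + (z - w)\<close>; symmetry merges the
  two cross terms.\<close>

lemma symmetric_three_point:
  fixes M :: "real^'n^'n"
  assumes "transpose M = M"
  shows "2 * ((z - x) \<bullet> (M *v (z - w)))
    = (x - z) \<bullet> (M *v (x - z)) + (z - w) \<bullet> (M *v (z - w)) - (x - w) \<bullet> (M *v (x - w))"
  using symmetric_matrix_inner[OF assms, of x z] symmetric_matrix_inner[OF assms, of x w]
    symmetric_matrix_inner[OF assms, of z w]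
  by (simp add: matrix_vector_mult_diff_distrib inner_diff_left inner_diff_right)

section \<open>Convexity, slacks and the optimality condition of one step\<close>

lemma qp_obj_diff_le:
  assumes "transpose Q = Q" "pos_semidef Q"
  shows "qp_obj Q b z - qp_obj Q b x \<le> (z - x) \<bullet> (Q *v z + b)"
proof -
  \<comment> \<open>Half of this form is exactly the gap between the two sides.\<close>
  have "0 \<le> (z - x) \<bullet> (Q *v (z - x))" using assms(2) by (simp add: pos_semidef_def)
  then show ?thesis
    using symmetric_matrix_inner[OF assms(1), of x z]
    by (simp add: qp_obj_def matrix_vector_mult_diff_distrib inner_diff_left inner_diff_right
        inner_add_right inner_commute)
qed

lemma slack_eq_component: "slack A c x j = c $ j - (transpose A *v x) $ j"
  by (simp add: slack_def matrix_vector_mul_component transpose_def column_def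
      del: transpose_matrix_vector)

lemma qp_feasible_iff_slack: "qp_feasible A c x \<longleftrightarrow> (\<forall>j. 0 \<le> slack A c x j)"
  by (simp add: qp_feasible_def slack_eq_component)

lemma qp_interior_iff_slack: "qp_interior A c x \<longleftrightarrow> (\<forall>j. 0 < slack A c x j)"
  by (simp add: qp_interior_def slack_eq_component)

text \<open>The minimizer \<open>z\<close> lies in the open domain of the logarithms, so the
  derivative of the step objective vanishes there in every direction \<open>d\<close>.\<close>

lemma qp_step_first_order:
  fixes A :: "real^'p^'n"
  assumes step: "qp_step Q b A c \<Sigma> w z" and sym: "transpose (matrix_inv \<Sigma>) = matrix_inv \<Sigma>"
  shows "(\<Sum>j\<in>UNIV. (column j A \<bullet> d) * (slack A c w j / slack A c z j - 1))
    + d \<bullet> (Q *v z + b) + d \<bullet> ((matrix_inv \<Sigma> - Q) *v (z - w)) = 0"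
proof -
  define L where "L = matrix_inv \<Sigma>"
  define \<nu> where "\<nu> = b - (L - Q) *v w"
  define g where "g h = step_obj Q b A c \<Sigma> w (z + h *\<^sub>R d)" for h
  have pos: "0 < slack A c z j" for j
    using step by (simp add: qp_step_def is_arg_min_def)
  have lin: "slack A c (z + h *\<^sub>R d) j = slack A c z j - h * (column j A \<bullet> d)" for h j
    by (simp add: slack_def inner_add_right)
  have Ldz: "z \<bullet> (L *v d) = d \<bullet> (L *v z)"
    using symmetric_matrix_inner sym unfolding L_def by blast
  have g_eq: "g h = - (\<Sum>j\<in>UNIV. (column j A \<bullet> z + h * (column j A \<bullet> d))
        + slack A c w j * ln (slack A c z j - h * (column j A \<bullet> d)))
      + (1/2) * (z \<bullet> (L *v z) + 2 * h * (d \<bullet> (L *v z)) + h * h * (d \<bullet> (L *v d)))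
      + (\<nu> \<bullet> z + h * (\<nu> \<bullet> d))" for h
    unfolding g_def step_obj_def Let_def lin
    by (simp add: \<nu>_def L_def[symmetric] inner_add_left inner_add_right matrix_vector_right_distrib
        matrix_vector_mult_scaleR Ldz algebra_simps)
  define D where "D = - (\<Sum>j\<in>UNIV. column j A \<bullet> d
        + slack A c w j * (- (column j A \<bullet> d) / slack A c z j)) + d \<bullet> (L *v z) + \<nu> \<bullet> d"
  have deriv: "(g has_real_derivative D) (at 0)"
    unfolding g_eq[abs_def] D_def
    by (rule derivative_eq_intros refl | simp add: pos mult.commute)+
  \<comment> \<open>Finitely many strict inequalities survive small moves along \<open>d\<close> of
    either sign, so \<open>h = 0\<close> is a two-sided local minimum of \<open>g\<close>.\<close>
  have "\<forall>\<^sub>F h in at 0. \<forall>j. 0 < slack A c (z + h *\<^sub>R d) j"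
  proof (intro eventually_all_finite)
    fix j
    have "((\<lambda>h. slack A c z j - h * (column j A \<bullet> d)) \<longlongrightarrow> slack A c z j - 0 * (column j A \<bullet> d)) (at 0)"
      by (intro tendsto_intros)
    then show "\<forall>\<^sub>F h in at 0. 0 < slack A c (z + h *\<^sub>R d) j"
      unfolding lin using pos[of j] by (intro order_tendstoD(1)) auto
  qed
  then obtain e where e: "0 < e"
    "\<And>h. h \<noteq> 0 \<Longrightarrow> \<bar>h\<bar> < e \<Longrightarrow> \<forall>j. 0 < slack A c (z + h *\<^sub>R d) j"
    unfolding eventually_at by (auto simp: dist_real_def)
  have "g 0 \<le> g h" if "\<bar>0 - h\<bar> < e" for h
  proof (cases "h = 0")
    case False
    then show ?thesis
      using step e(2)[of h] that by (auto simp: g_def qp_step_def is_arg_min_linorder)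
  qed simp
  then have "D = 0" using DERIV_local_min[OF deriv e(1)] by blast
  moreover have "column j A \<bullet> d + slack A c w j * (- (column j A \<bullet> d) / slack A c z j)
      = - ((column j A \<bullet> d) * (slack A c w j / slack A c z j - 1))" for j
    by (simp add: right_diff_distrib)
  then have "D = (\<Sum>j\<in>UNIV. (column j A \<bullet> d) * (slack A c w j / slack A c z j - 1))
    + d \<bullet> (L *v z) + \<nu> \<bullet> d"
    unfolding D_def by (simp only: sum_negf minus_minus)
  \<comment> \<open>By the choice of \<open>\<nu>\<close>, \<open>L *v z + \<nu>\<close> equals
    \<open>Q *v z + b\<close> plus \<open>(L - Q) *v (z - w)\<close>: the gradient of the quadratic
    objective plus the proximal term.\<close>
  ultimately show ?thesis
    by (simp add: \<nu>_def L_def[symmetric] matrix_vector_mult_diff_distrib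
        matrix_vector_mult_diff_rdistrib inner_diff_left inner_diff_right inner_add_right
        inner_commute algebra_simps)
qed

section \<open>Lyapunov function and its descent\<close>

definition lyapunov ::
  "real^'p^'n \<Rightarrow> real^'p \<Rightarrow> real^'n^'n \<Rightarrow> real^'n \<Rightarrow> real^'n \<Rightarrow> real" where
  "lyapunov A c P x z = (\<Sum>j\<in>UNIV. kl_div (slack A c x j) (slack A c z j))
     + (1/2) * ((x - z) \<bullet> (P *v (x - z)))"

lemma lyapunov_ge_quadratic:
  assumes "qp_feasible A c x" "qp_interior A c z"
  shows "(1/2) * ((x - z) \<bullet> (P *v (x - z))) \<le> lyapunov A c P x z"
  using assms
  by (auto simp: lyapunov_def qp_feasible_iff_slack qp_interior_iff_slack
      intro!: sum_nonneg kl_div_nonneg)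

lemma tendsto_lyapunov_self:
  assumes "qp_feasible A c x" "(f \<longlongrightarrow> x) F"
  shows "((\<lambda>i. lyapunov A c P x (f i)) \<longlongrightarrow> 0) F"
proof -
  have "((\<lambda>i. slack A c (f i) j) \<longlongrightarrow> slack A c x j) F" for j
    unfolding slack_def by (intro tendsto_intros assms)
  then have "((\<lambda>i. kl_div (slack A c x j) (slack A c (f i) j)) \<longlongrightarrow> 0) F" for j
    using assms(1) by (intro tendsto_kl_div_self) (auto simp: qp_feasible_iff_slack)
  then have "((\<lambda>i. \<Sum>j\<in>UNIV. kl_div (slack A c x j) (slack A c (f i) j)) \<longlongrightarrow> 0) F"
    by (rule tendsto_null_sum)
  moreover have "((\<lambda>i. (1/2) * ((x - f i) \<bullet> (P *v (x - f i)))) 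
      \<longlongrightarrow> (1/2) * ((x - x) \<bullet> (P *v (x - x)))) F"
    by (intro tendsto_intros assms bounded_linear.tendsto[OF matrix_vector_mul_bounded_linear])
  ultimately show ?thesis
    unfolding lyapunov_def using tendsto_add by fastforce
qed

lemma qp_step_interior: "qp_step Q b A c \<Sigma> w z \<Longrightarrow> qp_interior A c z"
  by (simp add: qp_step_def is_arg_min_def qp_interior_iff_slack)

text \<open>Test the first-order condition with \<open>d = z - x\<close>, for which
  \<open>column j A \<bullet> d\<close> is the slack at \<open>x\<close> minus the slack at
  \<open>z\<close>. The entropy terms come from \<open>kl_div_diff_ge\<close>, the quadratic ones
  from the three-point identity after dropping the nonnegative term in \<open>z - w\<close>.\<close>

lemma qp_step_descent:
  assumes "transpose Q = Q" "pos_semidef Q" "transpose (matrix_inv \<Sigma>) = matrix_inv \<Sigma>"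
    and "pos_def (matrix_inv \<Sigma> - Q)"
    and "qp_feasible A c x" "qp_interior A c w" "qp_step Q b A c \<Sigma> w z"
  shows "qp_obj Q b z - qp_obj Q b x
    \<le> lyapunov A c (matrix_inv \<Sigma> - Q) x w - lyapunov A c (matrix_inv \<Sigma> - Q) x z"
proof -
  define P where "P = matrix_inv \<Sigma> - Q"
  define r where "r j = slack A c w j / slack A c z j - 1" for j
  have P_sym: "transpose P = P"
    using assms(1,3) by (simp add: P_def transpose_def vec_eq_iff)
  have nonneg: "0 \<le> (z - w) \<bullet> (P *v (z - w))"
    using assms(4) unfolding P_def pos_def_def
    by (metis inner_zero_left less_imp_le order_refl)
  have foc: "(\<Sum>j\<in>UNIV. (column j A \<bullet> (z - x)) * r j)
      + (z - x) \<bullet> (Q *v z + b) + (z - x) \<bullet> (P *v (z - w)) = 0"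
    unfolding P_def r_def by (rule qp_step_first_order[OF assms(7,3)])
  have "- (\<Sum>j\<in>UNIV. (column j A \<bullet> (z - x)) * r j)
    = (\<Sum>j\<in>UNIV. - ((slack A c x j - slack A c z j) * r j))"
    by (simp add: slack_def inner_diff_right sum_negf)
  also have "\<dots> \<le> (\<Sum>j\<in>UNIV. kl_div (slack A c x j) (slack A c w j)
      - kl_div (slack A c x j) (slack A c z j))"
    unfolding r_def using assms(5,6) qp_step_interior[OF assms(7)]
    by (intro sum_mono kl_div_diff_ge) (auto simp: qp_feasible_iff_slack qp_interior_iff_slack)
  finally show ?thesis
    using foc nonneg qp_obj_diff_le[OF assms(1,2), of b z x] symmetric_three_point[OF P_sym, of z x w]
    unfolding P_def[symmetric] lyapunov_def by (simp add: sum_subtractf)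
qed

section \<open>Convergence of the iterates\<close>

lemma decseq_tendsto_of_subseq:
  fixes X :: "nat \<Rightarrow> real"
  assumes "decseq X" "strict_mono r" "(X \<circ> r) \<longlonglongrightarrow> l"
  shows "X \<longlonglongrightarrow> l"
proof -
  \<comment> \<open>The subsequence limit bounds the decreasing sequence below, so the whole
    sequence converges, necessarily to the same limit.\<close>
  have "l \<le> X t" for t
  proof (rule LIMSEQ_le_const2[OF assms(3)], intro exI allI impI)
    fix n assume "t \<le> n"
    then have "t \<le> r n" using seq_suble[OF assms(2), of n] by simp
    then show "(X \<circ> r) n \<le> X t" using assms(1) by (simp add: decseq_def)
  qed
  then obtain l' where l': "X \<longlonglongrightarrow> l'" using decseq_convergent[OF assms(1)] by blast
  then show ?thesis
    using LIMSEQ_unique[OF LIMSEQ_subseq_LIMSEQ[OF l' assms(2)] assms(3)] by simp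
qed

theorem proposition5p3:
  fixes Q \<Sigma> :: "real^'n^'n" and A :: "real^'p^'n"
    and b :: "real^'n" and c :: "real^'p"
    and \<theta> :: "nat \<Rightarrow> real^'n"
  assumes "transpose Q = Q" and "pos_semidef Q"
    and "rank A = CARD('n)"
    and "\<exists>x. qp_interior A c x"
    and "\<exists>x. qp_optimal Q b A c x"
    and "transpose \<Sigma> = \<Sigma>" and "pos_def \<Sigma>"
    and "pos_def (matrix_inv \<Sigma> - Q)"
    and "qp_interior A c (\<theta> 0)"
    and "\<And>t. qp_step Q b A c \<Sigma> (\<theta> t) (\<theta> (Suc t))"
  shows "\<exists>\<theta>star. qp_optimal Q b A c \<theta>star \<and> \<theta> \<longlonglongrightarrow> \<theta>star \<and>
           ({x. qp_obj Q b x = qp_obj Q b \<theta>star} \<noteq> {} \<longrightarrow>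
             (\<exists>\<theta>opt. qp_optimal Q b A c \<theta>opt \<and> \<theta> \<longlonglongrightarrow> \<theta>opt))"
proof -
  define f where "f = qp_obj Q b"
  define V where "V = lyapunov A c (matrix_inv \<Sigma> - Q)"
  have interior: "qp_interior A c (\<theta> t)" for t
    using assms(9) qp_step_interior[OF assms(10)] by (cases t) simp_all
  then have feasible: "qp_feasible A c (\<theta> t)" for t
    by (meson less_imp_le qp_feasible_def qp_interior_def)
  have optimal_iff: "qp_optimal Q b A c x \<longleftrightarrow> qp_feasible A c x \<and> (\<forall>y. qp_feasible A c y \<longrightarrow> f x \<le> f y)"
    for x by (simp add: qp_optimal_def is_arg_min_linorder f_def)
  have inv_sym: "transpose (matrix_inv \<Sigma>) = matrix_inv \<Sigma>"
    using assms(6,7) by (intro transpose_matrix_inv_symmetric pos_def_invertible)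
  have descent: "f (\<theta> (Suc t)) - f x \<le> V x (\<theta> t) - V x (\<theta> (Suc t))" if "qp_feasible A c x" for x t
    unfolding f_def V_def
    by (rule qp_step_descent[OF assms(1,2) inv_sym assms(8) that interior assms(10)])
  \<comment> \<open>For optimal \<open>x\<close> the left side of \<open>descent\<close> is
    nonnegative, since every iterate is feasible.\<close>
  have decseq_V: "decseq (\<lambda>t. V x (\<theta> t))" if "qp_optimal Q b A c x" for x
    using descent that feasible unfolding optimal_iff
    by (intro decseq_SucI) (smt (verit))
  obtain m where m: "0 < m"
    "\<And>x. m * (norm x)\<^sup>2 \<le> x \<bullet> ((matrix_inv \<Sigma> - Q) *v x)"
    using pos_def_coercive[OF assms(8)] by blast
  have V_ge: "m / 2 * (norm (\<theta> t - x))\<^sup>2 \<le> V x (\<theta> t)" if "qp_feasible A c x" for x t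
    using m(2)[of "x - \<theta> t", unfolded norm_minus_commute[of x]] lyapunov_ge_quadratic[OF that interior[of t], of "matrix_inv \<Sigma> - Q"]
    unfolding V_def by linarith
  obtain x0 where x0: "qp_optimal Q b A c x0" using assms(5) by blast
  then have x0_feasible: "qp_feasible A c x0" by (simp add: optimal_iff)
  have "convergent (\<lambda>t. V x0 (\<theta> t))"
  proof -
    have "0 \<le> V x0 (\<theta> t)" for t
      using V_ge[OF x0_feasible, of t] m(1)
      by (meson half_gt_zero less_imp_le mult_nonneg_nonneg order_trans zero_le_power2)
    then show ?thesis
      using decseq_convergent[OF decseq_V[OF x0]] by (metis convergentI)
  qed
  then obtain l where l: "(\<lambda>t. V x0 (\<theta> t)) \<longlonglongrightarrow> l" by (auto simp: convergent_def)
  \<comment> \<open>The objective gap is squeezed between 0 and the difference of consecutive terms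
    of a convergent sequence.\<close>
  have "(\<lambda>t. f (\<theta> (Suc t)) - f x0) \<longlonglongrightarrow> 0"
  proof (rule tendsto_sandwich[OF _ _ tendsto_const])
    have "(\<lambda>t. V x0 (\<theta> t) - V x0 (\<theta> (Suc t))) \<longlonglongrightarrow> l - l"
      by (intro tendsto_diff l LIMSEQ_Suc)
    then show "(\<lambda>t. V x0 (\<theta> t) - V x0 (\<theta> (Suc t))) \<longlonglongrightarrow> 0" by simp
    show "\<forall>\<^sub>F t in sequentially. 0 \<le> f (\<theta> (Suc t)) - f x0"
      using x0 feasible by (simp add: optimal_iff)
    show "\<forall>\<^sub>F t in sequentially. f (\<theta> (Suc t)) - f x0 \<le> V x0 (\<theta> t) - V x0 (\<theta> (Suc t))"
      by (intro always_eventually allI descent x0_feasible)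
  qed
  then have f_lim: "(\<lambda>t. f (\<theta> t)) \<longlonglongrightarrow> f x0"
    by (rule LIMSEQ_imp_Suc[OF LIM_zero_cancel])
  \<comment> \<open>Coercivity and the decrease of \<open>V x0\<close> keep all iterates in a ball
    around \<open>x0\<close>.\<close>
  have "bounded (range \<theta>)"
  proof -
    have "norm (\<theta> t - x0) \<le> sqrt (2 / m * V x0 (\<theta> 0))" for t
    proof (rule real_le_rsqrt)
      have "m / 2 * (norm (\<theta> t - x0))\<^sup>2 \<le> V x0 (\<theta> 0)"
        using V_ge[OF x0_feasible, of t] decseqD[OF decseq_V[OF x0], of 0 t] by linarith
      then show "(norm (\<theta> t - x0))\<^sup>2 \<le> 2 / m * V x0 (\<theta> 0)"
        using m(1) by (simp add: field_simps)
    qed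
    then have "range \<theta> \<subseteq> cball x0 (sqrt (2 / m * V x0 (\<theta> 0)))"
      by (auto simp: dist_norm norm_minus_commute)
    then show ?thesis using bounded_subset bounded_cball by blast
  qed
  then obtain x r where r: "strict_mono r" and x: "(\<theta> \<circ> r) \<longlonglongrightarrow> x"
    using bounded_imp_convergent_subsequence by blast
  have "qp_feasible A c x"
    unfolding qp_feasible_iff_slack
  proof
    fix j
    have "(\<lambda>i. slack A c ((\<theta> \<circ> r) i) j) \<longlonglongrightarrow> slack A c x j"
      unfolding slack_def by (intro tendsto_intros x)
    then show "0 \<le> slack A c x j"
      using feasible by (intro LIMSEQ_le_const) (auto simp: qp_feasible_iff_slack)
  qed
  moreover have "f x = f x0"
  proof (rule LIMSEQ_unique)
    show "(\<lambda>i. f ((\<theta> \<circ> r) i)) \<longlonglongrightarrow> f x"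
      unfolding f_def qp_obj_def
      by (intro tendsto_intros x bounded_linear.tendsto[OF matrix_vector_mul_bounded_linear])
    show "(\<lambda>i. f ((\<theta> \<circ> r) i)) \<longlonglongrightarrow> f x0"
      using LIMSEQ_subseq_LIMSEQ[OF f_lim r] by (simp add: o_def)
  qed
  ultimately have x_opt: "qp_optimal Q b A c x" using x0 by (simp add: optimal_iff)
  \<comment> \<open>The reference point changes from \<open>x0\<close> to the cluster point
    \<open>x\<close>: being optimal, \<open>x\<close> has its own decreasing \<open>V x\<close>,
    whose limit along \<open>r\<close> is 0.\<close>
  have "(\<lambda>i. V x ((\<theta> \<circ> r) i)) \<longlonglongrightarrow> 0"
    unfolding V_def using \<open>qp_feasible A c x\<close> x by (rule tendsto_lyapunov_self)
  then have V_lim: "(\<lambda>t. V x (\<theta> t)) \<longlonglongrightarrow> 0"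
    by (intro decseq_tendsto_of_subseq[OF decseq_V[OF x_opt] r]) (simp add: o_def)
  have "(\<lambda>t. (norm (\<theta> t - x))\<^sup>2) \<longlonglongrightarrow> 0"
  proof (rule tendsto_sandwich[OF _ _ tendsto_const[of 0]])
    show "(\<lambda>t. 2 / m * V x (\<theta> t)) \<longlonglongrightarrow> 0"
      by (rule tendsto_mult_right_zero[OF V_lim])
    show "\<forall>\<^sub>F t in sequentially. (norm (\<theta> t - x))\<^sup>2 \<le> 2 / m * V x (\<theta> t)"
      using V_ge[OF \<open>qp_feasible A c x\<close>] m(1)
      by (intro always_eventually allI) (simp add: field_simps)
  qed simp
  then have "\<theta> \<longlonglongrightarrow> x"
    by (simp add: LIM_zero_iff tendsto_norm_zero_iff)
  \<comment> \<open>The same \<open>x\<close> serves as witness for both existential claims.\<close>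
  with x_opt show ?thesis by blast
qed

end
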